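(* Let $n\ge 1$. The map $T:\Omega^0_n\times\{0,\dots,n\}\to\Omega^0_n$ defined below is the first component of a bijection $\bar T$ from $\Omega^0_n\times\{0,\dots,n\}$ onto itself; that is, there exists a bijection $\bar T:\Omega^0_n\times\{0,\dots,n\}\to\Omega^0_n\times\{0,\dots,n\}$ and a map $J$ with $\bar T(\omega,i)=(T(\omega,i),J(\omega,i))$ for all $(\omega,i)$.
   Context: A complete configuration of length $n$ is a pair of rows (top and bottom) of $n$ cells each, each cell containing a black ($\bullet$) or a white ($\circ$) particle, such that (i) the two rows together contain $n$ black and $n$ white particles, and (ii) for every $j\in\{0,\dots,n\}$ the first $j$ columns contain at least as many black as white particles. $\Omega^0_n$ is the set of these. Columns are numbered $1,\dots,n$ from left to right; walls are numbered $0,\dots,n$, wall $i$ lying between columns $i$ and $i+1$ (wall $0$ is the left border, wall $n$ the right border). Write $t_c,b_c$ for the top and bottom particles of column $c$. For $\omega\in\Omega^0_n$ and $i\in\{0,\dots,n\}$, $T(\omega,i)$ is defined by cases (in every case the particles not mentioned keep their relative order in their row): (a') If $1\le i\le n-1$, $t_i=\bullet$, $t_{i+1}=\circ$, $b_{i+1}=\bullet$: let $j_1$ be the smallest $j\in\{0,\dots,i-1\}$ such that $t_{j+1},\dots,t_{i-1}$ are all white; $T(\omega,i)$ is obtained by removing column $i+1$ and reinserting it so that it becomes column $j_1+1$. (a'') If $1\le i\le n-1$, $t_i=\bullet$, $t_{i+1}=\circ$, $b_{i+1}=\circ$: let $j_2$ be the largest $j\in\{i+1,\dots,n\}$ such that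 $t_{i+2},\dots,t_j$ are all black; the top row of $T(\omega,i)$ is obtained by deleting $t_i$ and inserting a black particle so that it becomes top cell $j_2$; the bottom row is obtained by deleting $b_{i+1}$ and inserting a white particle so that it becomes bottom cell $j_2+1$ if $j_2<n$, and bottom cell $n$ if $j_2=n$. (b) If $i=0$ and $t_1=\circ$ (then $b_1=\bullet$): let $j_2$ be the largest $j\in\{1,\dots,n\}$ such that $t_2,\dots,t_j$ are all black; delete column $1$, then insert a black particle in the top row so that it becomes top cell $j_2$, and a white particle in the bottom row so that it becomes bottom cell $j_2+1$ if $j_2<n$, bottom cell $n$ if $j_2=n$. (c) If $i=n$ and $t_n=\bullet$ (then $b_n=\circ$): let $j_1$ be the smallest $j\in\{0,\dots,n-1\}$ such that $t_{j+1},\dots,t_{n-1}$ are all white; delete column $n$ and insert a column with $\circ$ on top and $\bullet$ below so that it becomes column $j_1+1$. (d) Otherwise $T(\omega,i)=\omega$. *)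

theory Defs
  imports Main
begin

datatype particle = Black | White

text \<open>A configuration is the pair of its top row and its bottom row, both read from left to right.\<close>

type_synonym config = "particle list \<times> particle list"

definition complete_configs :: "nat \<Rightarrow> config set" where
  "complete_configs n = {(t, b).
     length t = n \<and> length b = n \<and>
     count_list (t @ b) Black = n \<and> count_list (t @ b) White = n \<and>
     (\<forall>j\<in>{0..n}. count_list (take j t @ take j b) White
                   \<le> count_list (take j t @ take j b) Black)}"

text \<open>Columns are numbered from 1, so cell \<open>k\<close> of a row is list element \<open>k - 1\<close>. The following
  functions are only meant for positions \<open>k \<ge> 1\<close>; \<open>insert_cell k x xs\<close> is the row whose
  \<open>k\<close>-th cell is the inserted particle \<open>x\<close>.\<close>

definition cell :: "'a list \<Rightarrow> nat \<Rightarrow> 'a" where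
  "cell xs k = xs ! (k - 1)"

definition delete_cell :: "nat \<Rightarrow> 'a list \<Rightarrow> 'a list" where
  "delete_cell k xs = take (k - 1) xs @ drop k xs"

definition insert_cell :: "nat \<Rightarrow> 'a \<Rightarrow> 'a list \<Rightarrow> 'a list" where
  "insert_cell k x xs = take (k - 1) xs @ x # drop (k - 1) xs"

text \<open>The walls \<open>j\<^sub>1\<close> and \<open>j\<^sub>2\<close> for a top row \<open>t\<close> and a wall \<open>i\<close>. The sets are finite; the first
  contains \<open>i - 1\<close> if \<open>i \<ge> 1\<close>, the second contains \<open>i + 1\<close> if \<open>i < n\<close>.\<close>

definition left_wall :: "particle list \<Rightarrow> nat \<Rightarrow> nat" where
  "left_wall t i = Min {j \<in> {0..i-1}. \<forall>k\<in>{j+1..i-1}. cell t k = White}"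

definition right_wall :: "nat \<Rightarrow> particle list \<Rightarrow> nat \<Rightarrow> nat" where
  "right_wall n t i = Max {j \<in> {i+1..n}. \<forall>k\<in>{i+2..j}. cell t k = Black}"

text \<open>Case distinctions on the wall \<open>i\<close>. In the first branch column \<open>i + 1\<close> (white above black) moves
  left; \<open>T\<close> is meant for \<open>(t, b)\<close> in \<^term>\<open>complete_configs n\<close> and \<open>i \<le> n\<close>. The positions of the
  inserted particles are positions in the resulting rows.\<close>

definition T :: "nat \<Rightarrow> config \<Rightarrow> nat \<Rightarrow> config" where
  "T n \<omega> i = (let t = fst \<omega>; b = snd \<omega>; j1 = left_wall t i; j2 = right_wall n t i in
     if 1 \<le> i \<and> i < n \<and> cell t i = Black \<and> cell t (i+1) = White \<and> cell b (i+1) = Black then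
       (insert_cell (j1+1) (cell t (i+1)) (delete_cell (i+1) t),
        insert_cell (j1+1) (cell b (i+1)) (delete_cell (i+1) b))
     else if 1 \<le> i \<and> i < n \<and> cell t i = Black \<and> cell t (i+1) = White \<and> cell b (i+1) = White then
       (insert_cell j2 Black (delete_cell i t),
        insert_cell (if j2 < n then j2+1 else n) White (delete_cell (i+1) b))
     else if i = 0 \<and> cell t 1 = White then
       (insert_cell j2 Black (delete_cell 1 t),
        insert_cell (if j2 < n then j2+1 else n) White (delete_cell 1 b))
     else if i = n \<and> cell t n = Black then
       (insert_cell (j1+1) White (delete_cell n t),
        insert_cell (j1+1) Black (delete_cell n b))
     else \<omega>)"

end

theory Submission
  imports Defs
begin

text \<open>The second component of the bijection is the wall where the moved particles end up: \<open>j\<^sub>1\<close> for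
  a move to the left, \<open>j\<^sub>2\<close> for a move to the right, and \<open>i\<close> itself in the idle case (d). From the
  image and this wall the move can be undone: the run of white top particles to the right of the
  wall (respectively, of black ones to its left) shows how far the particles came, and this run
  reaches the border exactly if the move started there. Since the set of configurations is finite,
  injectivity suffices.\<close>

section \<open>Heights\<close>

primrec weight :: "particle \<Rightarrow> int" where
  "weight Black = 1"
| "weight White = -1"

text \<open>Condition (ii), read column by column: \<open>h\<close> is the surplus of black over
  white particles so far. An arbitrary starting height lets a suffix be studied apart from the
  prefix that leads to it.\<close>

fun nonneg_walk :: "int \<Rightarrow> particle list \<Rightarrow> particle list \<Rightarrow> bool" where
  "nonneg_walk h [] [] = (h = 0)"
| "nonneg_walk h (x # t) (y # b) = (0 \<le> h \<and> nonneg_walk (h + weight x + weight y) t b)"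
| "nonneg_walk h _ _ = False"

lemma nonneg_walk_start: "nonneg_walk h t b \<Longrightarrow> 0 \<le> h"
  by (induction h t b rule: nonneg_walk.induct) auto

lemma nonneg_walk_iff:
  assumes "length t = length b"
  shows "nonneg_walk h t b \<longleftrightarrow> h + sum_list (map weight t) + sum_list (map weight b) = 0 \<and>
    (\<forall>j\<le>length t. 0 \<le> h + sum_list (map weight (take j t)) + sum_list (map weight (take j b)))"
  using assms
proof (induction t b arbitrary: h rule: list_induct2)
  case (Cons x t y b)
  \<comment> \<open>The empty prefix yields the test \<open>0 \<le> h\<close>; the nonempty ones are
    the prefixes of the tail, walked from the height after the first column.\<close>
  have "(\<forall>j\<le>Suc m. P j) \<longleftrightarrow> P 0 \<and> (\<forall>j\<le>m. P (Suc j))" for m and P :: "nat \<Rightarrow> bool"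
    using All_less_Suc2[of "Suc m" P] by (simp add: less_Suc_eq_le)
  then show ?case
    by (auto simp: Cons.IH algebra_simps)
qed auto

lemma sum_weight: "sum_list (map weight xs) = int (count_list xs Black) - int (count_list xs White)"
proof (induction xs)
  case (Cons x xs)
  then show ?case by (cases x) auto
qed simp

lemma count_add: "count_list xs Black + count_list xs White = length xs"
proof (induction xs)
  case (Cons x xs)
  then show ?case by (cases x) auto
qed simp

lemma complete_configs_iff:
  "(t, b) \<in> complete_configs n \<longleftrightarrow> length t = n \<and> length b = n \<and> nonneg_walk 0 t b"
proof (cases "length t = n \<and> length b = n")
  case True
  then have "nonneg_walk 0 t b \<longleftrightarrow> sum_list (map weight (t @ b)) = 0 \<and>
      (\<forall>j\<le>n. 0 \<le> sum_list (map weight (take j t @ take j b)))"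
    by (simp add: nonneg_walk_iff)
  also have "\<dots> \<longleftrightarrow> count_list (t @ b) Black = count_list (t @ b) White \<and>
      (\<forall>j\<le>n. count_list (take j t @ take j b) White \<le> count_list (take j t @ take j b) Black)"
    by (simp only: sum_weight right_minus_eq diff_ge_0_iff_ge of_nat_eq_iff of_nat_le_iff)
  \<comment> \<open>There are 2n cells in all, so equal numbers of both colours must be n
    each.\<close>
  also have "count_list (t @ b) Black = count_list (t @ b) White \<longleftrightarrow>
      count_list (t @ b) Black = n \<and> count_list (t @ b) White = n"
    using True count_add[of "t @ b"] unfolding length_append by linarith
  finally show ?thesis
    using True by (simp add: complete_configs_def Ball_def)
qed (auto simp: complete_configs_def)

lemma finite_complete_configs: "finite (complete_configs n)"
proof (rule finite_subset)
  let ?L = "{xs. set xs \<subseteq> {Black, White} \<and> length xs = n}"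
  have "set xs \<subseteq> {Black, White}" for xs
    using particle.exhaust by blast
  then show "complete_configs n \<subseteq> ?L \<times> ?L"
    by (auto simp: complete_configs_def)
  show "finite (?L \<times> ?L)"
    by (intro finite_cartesian_product finite_lists_length_eq) auto
qed

text \<open>A prefix influences the rest of the walk only through the height at which the rest
  starts, so the induction merely carries this height along.\<close>

lemma nonneg_walk_append_mono:
  assumes "length u = length p" "nonneg_walk h (u @ t) (p @ b)"
    and "\<And>h. nonneg_walk h t b \<Longrightarrow> nonneg_walk h t' b'"
  shows "nonneg_walk h (u @ t') (p @ b')"
  using assms by (induction u p arbitrary: h rule: list_induct2) auto

text \<open>Such a column only repeats a height: the one at which the walk over \<open>t\<close> and
  \<open>b\<close> starts, which is nonnegative anyway.\<close>

lemma nonneg_walk_balanced_column: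
  assumes "length u = length p" "weight x + weight y = 0"
  shows "nonneg_walk h (u @ x # t) (p @ y # b) \<longleftrightarrow> nonneg_walk h (u @ t) (p @ b)"
  using assms
  by (induction u p arbitrary: h rule: list_induct2)
    (auto dest: nonneg_walk_start simp: add.assoc)

text \<open>Covers both positions of the white particle in a move to the right: bottom cell j2+1 if
  j2 < n, and cell n if j2 = n, where nothing is left to be skipped.\<close>

definition insert_second :: "'a \<Rightarrow> 'a list \<Rightarrow> 'a list" where
  "insert_second x xs = take 1 xs @ x # drop 1 xs"

lemma insert_second_simps [simp]:
  "insert_second x [] = [x]"
  "insert_second x (y # xs) = y # x # xs"
  by (simp_all add: insert_second_def)

lemma length_insert_second [simp]: "length (insert_second x xs) = Suc (length xs)"
  by (cases xs) auto

lemma insert_second_inj [simp]: "insert_second x xs = insert_second x ys \<longleftrightarrow> xs = ys"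
  by (cases xs; cases ys) auto

text \<open>If \<open>v\<close> is nonempty, its first column White over \<open>y\<close> turns into
  Black over \<open>y\<close> followed by White over White. The only new height is
  \<open>h + 1 + weight y\<close>, which is at least \<open>h\<close>, and the walk then returns to
  its old height. If \<open>v\<close> is empty, Black over White is appended at height 0. The run of
  length \<open>k\<close> is a common prefix.\<close>

lemma nonneg_walk_insert_second:
  assumes "length q = k" "length v = length r" "v = [] \<or> hd v = White"
    and "nonneg_walk h (replicate k Black @ v) (q @ r)"
  shows "nonneg_walk h (replicate k Black @ Black # v) (q @ insert_second White r)"
proof (rule nonneg_walk_append_mono[OF _ assms(4)])
  fix h assume *: "nonneg_walk h v r"
  show "nonneg_walk h (Black # v) (insert_second White r)"
  proof (cases r)
    case Nil
    then show ?thesis using * assms(2) by auto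
  next
    case (Cons y r')
    then obtain v' where "v = White # v'"
      using assms(2,3) by (cases v) auto
    then show ?thesis
      using * Cons by (auto dest: nonneg_walk_start simp: algebra_simps)
  qed
qed (use assms in simp)

section \<open>The bijection as a relation\<close>

text \<open>The active walls are the ones outside case (d), with the left border counted as black and the
  right border as white.\<close>

definition active :: "particle list \<Rightarrow> nat \<Rightarrow> bool" where
  "active t i \<longleftrightarrow> (i = 0 \<or> t ! (i - 1) = Black) \<and> (i = length t \<or> t ! i = White)"

text \<open>\<open>column\<close> is case (a') and \<open>border\<close> is case (c). The condition
  on \<open>u\<close> makes the white run maximal, so that \<open>length u\<close> is the wall j1;
  the bottom row is cut below the cuts of the top row.\<close>

inductive left_move :: "config \<times> nat \<Rightarrow> config \<times> nat \<Rightarrow> bool" where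
  column: "\<lbrakk>length p = length u; length q = k; length r = length v; u = [] \<or> last u = Black\<rbrakk> \<Longrightarrow>
    left_move
      ((u @ replicate k White @ Black # White # v, p @ q @ x # Black # r), length u + k + 1)
      ((u @ White # replicate k White @ Black # v, p @ Black # q @ x # r), length u)"
| border: "\<lbrakk>length p = length u; length q = k; u = [] \<or> last u = Black\<rbrakk> \<Longrightarrow>
    left_move
      ((u @ replicate k White @ [Black], p @ q @ [White]), length u + k + 1)
      ((u @ White # replicate k White, p @ Black # q), length u)"

text \<open>\<open>particles\<close> is case (a'') and \<open>border\<close> is case (b). The
  condition on \<open>v\<close> makes the black run maximal, so that the arrival wall is j2.\<close>

inductive right_move :: "config \<times> nat \<Rightarrow> config \<times> nat \<Rightarrow> bool" where
  particles: "\<lbrakk>length p = length u; length q = k; length r = length v; v = [] \<or> hd v = White\<rbrakk> \<Longrightarrow>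
    right_move
      ((u @ Black # White # replicate k Black @ v, p @ x # White # q @ r), length u + 1)
      ((u @ White # replicate k Black @ Black # v, p @ x # q @ insert_second White r), length u + k + 2)"
| border: "\<lbrakk>length q = k; length r = length v; v = [] \<or> hd v = White\<rbrakk> \<Longrightarrow>
    right_move
      ((White # replicate k Black @ v, Black # q @ r), 0)
      ((replicate k Black @ Black # v, q @ insert_second White r), k + 1)"

text \<open>A relation suffices: injectivity in the sense of \<open>step_inj\<close> passes to every
  function that selects one step for each input.\<close>

definition step :: "config \<times> nat \<Rightarrow> config \<times> nat \<Rightarrow> bool" where
  "step x y \<longleftrightarrow> left_move x y \<or> right_move x y \<or> x = y \<and> \<not> active (fst (fst x)) (snd x)"

text \<open>The column taken out and the column put in both have weight 0, so neither affects the
  nonnegativity of the walk.\<close>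

lemma left_move_closed:
  assumes "left_move x y" "x \<in> complete_configs n \<times> {0..n}"
  shows "y \<in> complete_configs n \<times> {0..n}"
  using assms
proof cases
  case (column p u q k r v x)
  then have "nonneg_walk 0 ((u @ replicate k White @ [Black]) @ White # v) ((p @ q @ [x]) @ Black # r)"
    using assms(2) by (simp add: complete_configs_iff)
  then have "nonneg_walk 0 (u @ replicate k White @ Black # v) (p @ q @ x # r)"
    using column by (subst (asm) nonneg_walk_balanced_column) auto
  then show ?thesis
    using column assms(2) by (auto simp: complete_configs_iff nonneg_walk_balanced_column)
next
  case (border p u q k)
  then have "nonneg_walk 0 ((u @ replicate k White) @ [Black]) ((p @ q) @ [White])"
    using assms(2) by (simp add: complete_configs_iff)
  then have "nonneg_walk 0 (u @ replicate k White) (p @ q)"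
    using border by (subst (asm) nonneg_walk_balanced_column) auto
  then show ?thesis
    using border assms(2) by (auto simp: complete_configs_iff nonneg_walk_balanced_column)
qed

lemma right_move_closed:
  assumes "right_move x y" "x \<in> complete_configs n \<times> {0..n}"
  shows "y \<in> complete_configs n \<times> {0..n}"
  using assms
proof cases
  case (particles p u q k r v x)
  have "nonneg_walk 0 (u @ White # replicate k Black @ Black # v) (p @ x # q @ insert_second White r)"
  proof (rule nonneg_walk_append_mono)
    show "nonneg_walk 0 (u @ Black # White # replicate k Black @ v) (p @ x # White # q @ r)"
      using particles assms(2) by (simp add: complete_configs_iff)
    \<comment> \<open>Both the old columns Black over \<open>x\<close>, White over White and the
      single new column White over \<open>x\<close> lead from \<open>h\<close> to
      \<open>h + weight x - 1\<close>. What follows therefore starts at the same height.\<close>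
    fix h assume "nonneg_walk h (Black # White # replicate k Black @ v) (x # White # q @ r)"
    then show "nonneg_walk h (White # replicate k Black @ Black # v) (x # q @ insert_second White r)"
      using particles by (auto simp: algebra_simps intro!: nonneg_walk_insert_second)
  qed (use particles in simp)
  then show ?thesis
    using particles assms(2) by (auto simp: complete_configs_iff)
next
  case (border q k r v)
  then show ?thesis
    using assms(2) by (auto simp: complete_configs_iff intro!: nonneg_walk_insert_second)
qed

lemma step_closed:
  "step x y \<Longrightarrow> x \<in> complete_configs n \<times> {0..n} \<Longrightarrow> y \<in> complete_configs n \<times> {0..n}"
  using left_move_closed right_move_closed unfolding step_def by blast

section \<open>Injectivity\<close>

lemma replicate_append_inj:
  assumes "replicate k a @ v = replicate l a @ w" "v = [] \<or> hd v \<noteq> a" "w = [] \<or> hd w \<noteq> a"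
  shows "k = l \<and> v = w"
  using assms
proof (induction k arbitrary: l)
  case 0
  then show ?case by (cases l) auto
next
  case (Suc k)
  then show ?case by (cases l) auto
qed

lemma append_replicate_inj:
  assumes "u @ x # replicate k a = w @ y # replicate l a" "x \<noteq> a" "y \<noteq> a"
  shows "k = l \<and> u = w \<and> x = y"
proof -
  have "replicate k a @ x # rev u = replicate l a @ y # rev w"
    using arg_cong[OF assms(1), of rev] by simp
  from replicate_append_inj[OF this] show ?thesis using assms(2,3) by simp
qed

text \<open>List indices start at 0, so \<open>b ! j\<close> is the bottom particle of column j+1,
  just right of wall \<open>j\<close>. The right border counts as not black.\<close>

definition black_below :: "config \<times> nat \<Rightarrow> bool" where
  "black_below = (\<lambda>((t, b), j). j < length b \<and> b ! j = Black)"

text \<open>The inserted column, White over Black, stands right of the arrival wall; left of it is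
  the last particle of \<open>u\<close>, which is Black, or the border.\<close>

lemma left_move_output:
  assumes "left_move x y"
  shows "active (fst (fst y)) (snd y) \<and> black_below y"
proof -
  have "active (u @ White # v) (length u)" if "u = [] \<or> last u = Black" for u v
    using that by (cases u rule: rev_cases) (auto simp: active_def nth_append)
  from assms this show ?thesis
    by cases (auto simp: black_below_def nth_append)
qed

lemma right_move_output:
  assumes "right_move x y"
  shows "active (fst (fst y)) (snd y) \<and> \<not> black_below y"
proof -
  \<comment> \<open>Both kinds of output have this shape, cut just before the inserted Black. As
    \<open>b\<close> ends one cell before the wall, \<open>insert_second\<close> puts its White
    right of the wall, unless the wall is the right border.\<close>
  have *: "active (t @ Black # v) j \<and> \<not> black_below ((t @ Black # v, b @ insert_second White r), j)"
    if "length t + 1 = j" "length b + 1 = j" "length r = length v" "v = [] \<or> hd v = White"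
    for t b v r and j :: nat
    using that by (cases v; cases r) (auto simp: black_below_def active_def nth_append)
  from assms show ?thesis
  proof cases
    case (particles p u q k r v x)
    then show ?thesis
      using *[of "u @ White # replicate k Black" _ "p @ x # q" r v] by simp
  next
    case (border q k r v)
    then show ?thesis
      using *[of "replicate k Black" _ q r v] by simp
  qed
qed

lemma left_move_inj:
  assumes "left_move x y" "left_move x' y"
  shows "x = x'"
proof -
  \<comment> \<open>The arrival wall is \<open>length u\<close>, so two decompositions of one output
    are cut at the same place; it remains to compare the white runs behind the cut.\<close>
  have rows: "u = u' \<and> replicate k White @ v = replicate k' White @ v' \<and> p = p' \<and> q = q'"
    if "((u @ White # replicate k White @ v, p @ Black # q), length u) =
        ((u' @ White # replicate k' White @ v', p' @ Black # q'), length u')"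
      and "length p = length u" "length p' = length u'"
    for u u' v v' p p' q q' k k'
    using that by auto
  from assms(1) show ?thesis
  proof cases
    case (column p u q k r v x)
    note 1 = this
    from assms(2) show ?thesis
    proof cases
      case (column p' u' q' k' r' v' x')
      have *: "u = u' \<and> replicate k White @ Black # v = replicate k' White @ Black # v' \<and>
          p = p' \<and> q @ x # r = q' @ x' # r'"
        by (rule rows) (use 1 column in simp_all)
      then have "k = k' \<and> v = v'"
        using replicate_append_inj[of k White "Black # v" k' "Black # v'"] by simp
      then show ?thesis
        using * 1(1,4) column(1,4) append_eq_append_conv[of q q'] by simp
    next
      case (border p' u' q' k')
      \<comment> \<open>Contradictory: in the case \<open>column\<close> a Black ends the white run,
        in the case \<open>border\<close> the run reaches the right border.\<close>
      have "u = u' \<and> replicate k White @ Black # v = replicate k' White @ [] \<and>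
          p = p' \<and> q @ x # r = q'"
        by (rule rows) (use 1 border in simp_all)
      then show ?thesis
        using replicate_append_inj[of k White "Black # v" k' "[]"] by simp
    qed
  next
    case (border p u q k)
    note 1 = this
    from assms(2) show ?thesis
    proof cases
      case (column p' u' q' k' r' v' x')
      have "u = u' \<and> replicate k White @ [] = replicate k' White @ Black # v' \<and>
          p = p' \<and> q = q' @ x' # r'"
        by (rule rows) (use 1 column in simp_all)
      then show ?thesis
        using replicate_append_inj[of k White "[]" k' "Black # v'"] by simp
    next
      case (border p' u' q' k')
      have "u = u' \<and> replicate k White @ [] = replicate k' White @ [] \<and> p = p' \<and> q = q'"
        by (rule rows) (use 1 border in simp_all)
      then show ?thesis
        using 1(1) border(1) by (simp add: replicate_eq_replicate)
    qed
  qed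
qed

text \<open>The arrival wall locates the inserted Black. The black run to its left is ended by a
  White after \<open>particles\<close> and reaches the left border after \<open>border\<close>; its
  length \<open>k\<close> then fixes all other cuts.\<close>

lemma right_move_inj:
  assumes "right_move x y" "right_move x' y"
  shows "x = x'"
  using assms(1)
proof cases
  case (particles p u q k r v x)
  note 1 = this
  from assms(2) show ?thesis
  proof cases
    case (particles p' u' q' k' r' v' x')
    have "(u @ White # replicate k Black) @ Black # v = (u' @ White # replicate k' Black) @ Black # v'"
      using 1 particles by simp
    then have "u @ White # replicate k Black = u' @ White # replicate k' Black \<and> v = v'"
      using 1 particles by (subst (asm) append_eq_append_conv) auto
    then show ?thesis
      using 1 particles append_replicate_inj[of u White k Black u' White k'] by auto
  next
    case (border q' k' r' v')
    have "(u @ White # replicate k Black) @ Black # v = replicate k' Black @ Black # v'"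
      using 1(2) border(2) by (metis append.assoc append_Cons fst_conv)
    then have "u @ White # replicate k Black = replicate k' Black"
      using 1 border by (subst (asm) append_eq_append_conv) auto
    then have "White \<in> set (replicate k' Black)"
      by (metis in_set_conv_decomp)
    then show ?thesis by simp
  qed
next
  case (border q k r v)
  note 1 = this
  from assms(2) show ?thesis
  proof cases
    case (particles p' u' q' k' r' v' x')
    have "(u' @ White # replicate k' Black) @ Black # v' = replicate k Black @ Black # v"
      using 1(2) particles(2) by (metis append.assoc append_Cons fst_conv)
    then have "u' @ White # replicate k' Black = replicate k Black"
      using 1 particles by (subst (asm) append_eq_append_conv) auto
    then have "White \<in> set (replicate k Black)"
      by (metis in_set_conv_decomp)
    then show ?thesis by simp
  next
    case (border q' k' r' v')
    have "k = k' \<and> v = v' \<and> q @ insert_second White r = q' @ insert_second White r'"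
      using 1(2) border(2) by auto
    then show ?thesis
      using 1 border by simp
  qed
qed

text \<open>The arrival wall reveals the kind of the step: only an idle step ends at an inactive wall, and
  the two kinds of moves differ in the particle to the right of that wall in the bottom row.\<close>

lemma step_inj: "step x y \<Longrightarrow> step x' y \<Longrightarrow> x = x'"
  unfolding step_def
  using left_move_inj right_move_inj left_move_output right_move_output by metis

section \<open>The steps realise the map\<close>

text \<open>A wall further left would require the last particle of \<open>u\<close> to be
  White.\<close>

lemma left_wall_eq:
  assumes "u = [] \<or> last u = Black"
  shows "left_wall (u @ replicate k White @ w) (length u + k + 1) = length u"
  unfolding left_wall_def
proof (rule Min_eqI)
  fix j
  assume j: "j \<in> {j \<in> {0..length u + k + 1 - 1}. \<forall>m\<in>{j+1..length u + k + 1 - 1}.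
    cell (u @ replicate k White @ w) m = White}"
  show "length u \<le> j"
  proof (rule ccontr)
    assume "\<not> length u \<le> j"
    then have "cell (u @ replicate k White @ w) (length u) = White" and "u \<noteq> []"
      using j by auto
    then show False
      using assms by (auto simp: cell_def nth_append last_conv_nth)
  qed
qed (auto simp: cell_def nth_append)

text \<open>\<open>s\<close> ends with column i+1, so the run fills cells i+2 to i+k+1. A wall
  further right would require the first particle of \<open>v\<close> to be Black.\<close>

lemma right_wall_eq:
  assumes "length s = i + 1" "v = [] \<or> hd v = White" "n = length s + k + length v"
  shows "right_wall n (s @ replicate k Black @ v) i = i + k + 1"
  unfolding right_wall_def
proof (rule Max_eqI)
  fix j
  assume j: "j \<in> {j \<in> {i+1..n}. \<forall>m\<in>{i+2..j}. cell (s @ replicate k Black @ v) m = Black}"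
  show "j \<le> i + k + 1"
  proof (rule ccontr)
    assume "\<not> j \<le> i + k + 1"
    then have "cell (s @ replicate k Black @ v) (i + k + 2) = Black" and "v \<noteq> []"
      using j assms by auto
    then show False
      using assms by (auto simp: cell_def nth_append hd_conv_nth)
  qed
qed (use assms in \<open>auto simp: cell_def nth_append\<close>)

section \<open>Cell operations on rows cut at the cell concerned\<close>

lemma insert_cell_append: "k = length s + 1 \<Longrightarrow> insert_cell k x (s @ w) = s @ x # w"
  by (simp add: insert_cell_def)

lemma delete_cell_append: "k = length s + 1 \<Longrightarrow> delete_cell k (s @ x # w) = s @ w"
  by (simp add: delete_cell_def)

lemma insert_cell_second:
  "k = (if r = [] then length s + 1 else length s + 2) \<Longrightarrow> insert_cell k x (s @ r) = s @ insert_second x r"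
  by (cases r) (simp_all add: insert_cell_def)

lemma cell_append: "k = length s + 1 \<Longrightarrow> cell (s @ x # w) k = x"
  by (simp add: cell_def)

lemma T_left_move:
  assumes "left_move (\<omega>, i) y" "n = length (fst \<omega>)"
  shows "T n \<omega> i = fst y"
  using assms(1)
proof cases
  case (column p u q k r v x)
  let ?u = "u @ replicate k White" and ?p = "p @ q"
  have "cell (fst \<omega>) i = Black" "cell (fst \<omega>) (i+1) = White" "cell (snd \<omega>) (i+1) = Black"
    using cell_append[of _ ?u] cell_append[of _ "?u @ [Black]"] cell_append[of _ "?p @ [x]"] column
    by auto
  moreover have "delete_cell (i+1) (fst \<omega>) = u @ replicate k White @ Black # v"
    using delete_cell_append[of _ "?u @ [Black]"] column by simp
  moreover have "delete_cell (i+1) (snd \<omega>) = p @ q @ x # r"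
    using delete_cell_append[of _ "?p @ [x]"] column by simp
  moreover have "left_wall (fst \<omega>) i = length u"
    using left_wall_eq column by simp
  ultimately show ?thesis
    using column assms(2) by (simp add: T_def insert_cell_append)
next
  case (border p u q k)
  have "cell (fst \<omega>) i = Black"
    using cell_append[of _ "u @ replicate k White"] border by auto
  moreover have "delete_cell i (fst \<omega>) = u @ replicate k White"
    using delete_cell_append[of _ "u @ replicate k White" _ "[]"] border by simp
  moreover have "delete_cell i (snd \<omega>) = p @ q"
    using delete_cell_append[of _ "p @ q" _ "[]"] border by simp
  moreover have "left_wall (fst \<omega>) i = length u"
    using left_wall_eq border by simp
  ultimately show ?thesis
    using border assms(2) by (simp add: T_def insert_cell_append)
qed

lemma T_right_move:
  assumes "right_move (\<omega>, i) y" "n = length (fst \<omega>)"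
  shows "T n \<omega> i = fst y"
  using assms(1)
proof cases
  case (particles p u q k r v x)
  let ?j = "length u + k + 2"
  have "cell (fst \<omega>) i = Black" "cell (fst \<omega>) (i+1) = White" "cell (snd \<omega>) (i+1) = White"
    using cell_append[of _ u] cell_append[of _ "u @ [Black]"] cell_append[of _ "p @ [x]"] particles
    by auto
  moreover have "delete_cell i (fst \<omega>) = u @ White # replicate k Black @ v"
    using particles by (simp add: delete_cell_append)
  moreover have "delete_cell (i+1) (snd \<omega>) = p @ x # q @ r"
    using delete_cell_append[of _ "p @ [x]"] particles by simp
  moreover have "right_wall n (fst \<omega>) i = ?j"
    using right_wall_eq[of "u @ [Black, White]" i v n k] particles assms(2) by simp
  moreover have "insert_cell ?j Black (u @ White # replicate k Black @ v)
      = u @ White # replicate k Black @ Black # v"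
    using insert_cell_append[of ?j "u @ White # replicate k Black"] by simp
  \<comment> \<open>Here \<open>n = ?j + length r\<close>, so \<open>?j < n\<close> says that
    \<open>r\<close> is nonempty, and \<open>?j - 1\<close> bottom cells precede
    \<open>r\<close>.\<close>
  moreover have "(if ?j < n then ?j + 1 else n)
      = (if r = [] then length (p @ x # q) + 1 else length (p @ x # q) + 2)"
    using particles assms(2) by auto
  from insert_cell_second[OF this, of White]
  have "insert_cell (if ?j < n then ?j + 1 else n) White (p @ x # q @ r)
      = p @ x # q @ insert_second White r"
    by simp
  ultimately show ?thesis
    using particles assms(2) by (cases "v = []") (simp_all add: T_def)
next
  case (border q k r v)
  let ?j = "k + 1"
  have "cell (fst \<omega>) 1 = White"
    using border by (simp add: cell_def)
  moreover have "delete_cell 1 (fst \<omega>) = replicate k Black @ v" "delete_cell 1 (snd \<omega>) = q @ r"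
    using border by (simp_all add: delete_cell_def)
  moreover have "right_wall n (fst \<omega>) i = ?j"
    using right_wall_eq[of "[White]" i v n k] border assms(2) by simp
  moreover have "insert_cell ?j Black (replicate k Black @ v) = replicate k Black @ Black # v"
    by (simp add: insert_cell_append)
  moreover have "(if ?j < n then ?j + 1 else n) = (if r = [] then length q + 1 else length q + 2)"
    using border assms(2) by auto
  from insert_cell_second[OF this, of White]
  have "insert_cell (if ?j < n then ?j + 1 else n) White (q @ r) = q @ insert_second White r" .
  ultimately show ?thesis
    using border assms(2) by (cases "v = []") (simp_all add: T_def)
qed

section \<open>Maximal runs and the existence of a move at every active wall\<close>

lemma split_trailing:
  obtains u k where "xs = u @ replicate k a" "u = [] \<or> last u \<noteq> a"
proof (induction xs arbitrary: thesis rule: rev_induct)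
  case (snoc x xs)
  show ?case
  proof (cases "x = a")
    case True
    from snoc.IH obtain u k where "xs = u @ replicate k a" "u = [] \<or> last u \<noteq> a" by blast
    then show ?thesis
      using True snoc.prems[of u "Suc k"] by (simp flip: replicate_append_same)
  next
    case False
    then show ?thesis using snoc.prems[of "xs @ [x]" 0] by simp
  qed
qed simp

lemma split_leading:
  obtains v k where "xs = replicate k a @ v" "v = [] \<or> hd v \<noteq> a"
proof -
  obtain u k where "rev xs = u @ replicate k a" and u: "u = [] \<or> last u \<noteq> a"
    by (rule split_trailing)
  then have "xs = replicate k a @ rev u"
    by (metis rev_append rev_replicate rev_rev_ident)
  then show thesis
    using that u by (simp add: hd_rev)
qed

lemma split_length:
  assumes "length xs = k + l"
  obtains p q where "xs = p @ q" "length p = k" "length q = l"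
  using assms that[of "take k xs" "drop k xs"] by simp

lemma not_White: "x \<noteq> White \<longleftrightarrow> x = Black" and not_Black: "x \<noteq> Black \<longleftrightarrow> x = White"
  by (cases x; simp)+

text \<open>The walk enters the last column at a nonnegative height and must leave it at 0, whereas
  Black over Black would raise it by 2.\<close>

lemma nonneg_walk_last:
  "length t = length b \<Longrightarrow> nonneg_walk h (t @ [Black]) (b @ [y]) \<Longrightarrow> y = White"
  by (induction t b arbitrary: h rule: list_induct2) (cases y; auto)+

lemma active_imp_move:
  assumes "(t, b) \<in> complete_configs n" "1 \<le> n" "i \<le> n" "active t i"
  shows "\<exists>y. left_move ((t, b), i) y \<or> right_move ((t, b), i) y"
proof -
  have len: "length t = n" "length b = n" and walk: "nonneg_walk 0 t b"
    using assms(1) by (auto simp: complete_configs_iff)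
  consider "i = 0" | "0 < i" "i < n" | "i = n" "0 < i"
    using assms(2,3) by linarith
  then show ?thesis
  proof cases
    case 1
    then obtain t' where t: "t = White # t'"
      using assms(2,4) len by (cases t) (auto simp: active_def)
    then obtain y b' where b: "b = y # b'" "length b' = length t'"
      using len by (cases b) auto
    \<comment> \<open>The walk starts at 0, and White over White would take it to -2.\<close>
    have "y = Black"
      using walk t b by (cases y) (auto dest: nonneg_walk_start)
    obtain v k where v: "t' = replicate k Black @ v" "v = [] \<or> hd v \<noteq> Black"
      by (rule split_leading)
    then obtain q r where "b' = q @ r" "length q = k" "length r = length v"
      using b split_length[of b' k "length v"] by auto
    then show ?thesis
      using right_move.border[of q k r v] v \<open>y = Black\<close> t b 1 by (auto simp: not_Black)
  next
    case 2
    \<comment> \<open>The cut isolates the two columns adjacent to wall \<open>i\<close>.\<close>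
    then have tb: "length t = (i - 1) + (2 + (n - i - 1))" "length b = (i - 1) + (2 + (n - i - 1))"
      using len by auto
    from split_length[OF tb(1)] obtain s v' where s: "t = s @ v'" "length s = i - 1" "length v' = 2 + (n - i - 1)" .
    then obtain x1 x2 v where v: "t = s @ x1 # x2 # v" "length v = n - i - 1"
      by (auto simp: length_Suc_conv numeral_2_eq_2)
    have x: "x1 = Black" "x2 = White"
      using assms(4) 2 v s len by (cases i; auto simp: active_def nth_append)+
    from split_length[OF tb(2)] obtain p v' where p: "b = p @ v'" "length p = i - 1" "length v' = 2 + (n - i - 1)" .
    then obtain y1 y2 r where r: "b = p @ y1 # y2 # r" "length r = n - i - 1"
      by (auto simp: length_Suc_conv numeral_2_eq_2)
    \<comment> \<open>The bottom particle right of the wall decides the direction: Black for case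
      (a'), White for case (a'').\<close>
    show ?thesis
    proof (cases y2)
      case Black
      obtain u k where u: "s = u @ replicate k White" "u = [] \<or> last u \<noteq> White"
        by (rule split_trailing)
      then obtain p1 q where "p = p1 @ q" "length p1 = length u" "length q = k"
        using s p split_length[of p "length u" k] by auto
      then show ?thesis
        using left_move.column[of p1 u q k r v y1] u x v r s Black 2 by (auto simp: not_White)
    next
      case White
      obtain v1 k where v1: "v = replicate k Black @ v1" "v1 = [] \<or> hd v1 \<noteq> Black"
        by (rule split_leading)
      then obtain q r1 where "r = q @ r1" "length q = k" "length r1 = length v1"
        using v r split_length[of r k "length v1"] by auto
      then show ?thesis
        using right_move.particles[of p s q k r1 v1 y1] v1 x v r s p White 2 by (auto simp: not_Black)
    qed
  next
    case 3
    then have "t \<noteq> []" "b \<noteq> []"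
      using len by auto
    then obtain s p y where t: "t = s @ [Black]" and b: "b = p @ [y]"
      using assms(4) 3 len by (cases t rule: rev_cases; cases b rule: rev_cases) (auto simp: active_def nth_append)
    then have "y = White"
      using walk len nonneg_walk_last[of s p 0 y] t b by simp
    obtain u k where u: "s = u @ replicate k White" "u = [] \<or> last u \<noteq> White"
      by (rule split_trailing)
    then obtain p1 q where "p = p1 @ q" "length p1 = length u" "length q = k"
      using t b len split_length[of p "length u" k] by auto
    then show ?thesis
      using left_move.border[of p1 u q k] u t b 3 len \<open>y = White\<close> by (auto simp: not_White)
  qed
qed

text \<open>Each of the four tests in \<open>T\<close> forces the wall to be active, so only the
  last branch remains.\<close>

lemma T_inactive:
  assumes "length (fst \<omega>) = n" "1 \<le> n" "\<not> active (fst \<omega>) i"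
  shows "T n \<omega> i = \<omega>"
  using assms by (auto simp: T_def Let_def active_def cell_def)

lemma step_T:
  assumes "\<omega> \<in> complete_configs n" "i \<le> n" "1 \<le> n"
  shows "\<exists>y. step (\<omega>, i) y \<and> fst y = T n \<omega> i"
proof (cases "active (fst \<omega>) i")
  case True
  then obtain y where "left_move (\<omega>, i) y \<or> right_move (\<omega>, i) y"
    using active_imp_move assms by (metis prod.collapse)
  moreover have "n = length (fst \<omega>)"
    using assms(1) by (auto simp: complete_configs_def)
  ultimately show ?thesis
    using T_left_move T_right_move unfolding step_def by metis
next
  case False
  have "length (fst \<omega>) = n"
    using assms(1) by (auto simp: complete_configs_def)
  from T_inactive[OF this assms(3) False] have "fst (\<omega>, i) = T n \<omega> i"
    by simp
  moreover have "step (\<omega>, i) (\<omega>, i)"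
    using False by (simp add: step_def)
  ultimately show ?thesis
    by blast
qed

theorem theorem1:
  fixes n :: nat
  assumes "n \<ge> 1"
  shows "\<exists>(Tbar :: config \<times> nat \<Rightarrow> config \<times> nat) (J :: config \<times> nat \<Rightarrow> nat).
           bij_betw Tbar (complete_configs n \<times> {0..n}) (complete_configs n \<times> {0..n}) \<and>
           (\<forall>\<omega>\<in>complete_configs n. \<forall>i\<in>{0..n}. Tbar (\<omega>, i) = (T n \<omega> i, J (\<omega>, i)))"
proof -
  let ?D = "complete_configs n \<times> {0..n}"
  have "\<forall>x\<in>?D. \<exists>y. step x y \<and> fst y = T n (fst x) (snd x)"
    using step_T assms by auto
  \<comment> \<open>\<open>Tbar\<close> selects a step whose configuration is the value of
    \<open>T\<close>; the map J is then its wall component \<open>snd \<circ> Tbar\<close>.\<close>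
  then obtain Tbar where Tbar: "\<And>x. x \<in> ?D \<Longrightarrow> step x (Tbar x)"
      "\<And>x. x \<in> ?D \<Longrightarrow> fst (Tbar x) = T n (fst x) (snd x)"
    by metis
  have "inj_on Tbar ?D"
    using Tbar(1) step_inj by (metis inj_onI)
  moreover have "Tbar ` ?D \<subseteq> ?D"
    using Tbar(1) step_closed by blast
  ultimately have "bij_betw Tbar ?D ?D"
    using finite_complete_configs by (simp add: bij_betw_def endo_inj_surj)
  moreover have "\<forall>\<omega>\<in>complete_configs n. \<forall>i\<in>{0..n}. Tbar (\<omega>, i) = (T n \<omega> i, (snd \<circ> Tbar) (\<omega>, i))"
    using Tbar(2) by (simp add: prod_eq_iff)
  ultimately show ?thesis
    by blast
qed

end
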